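(* Let $\lambda$ be a nonzero real number and let $Y$ be a real random variable whose moment generating function exists in a neighborhood of the origin and such that $E[Y]\ne0$. Let $q(x)$ be any polynomial of degree $n$ with complex coefficients, and let $$q(x)=\sum_{r=0}^{n}a_{r}\mathcal{E}_{r,\lambda}^{Y}(x).$$ Then, for $0\le r\le n$, the coefficients are determined by \begin{align*} a_{r}&=\frac{1}{2}\sum_{j=r}^{n}S_{1,\lambda}^{Y}(j,r)\frac{1}{j!}\big(\Delta^{j}q(1)+\Delta^{j}q(0) \big) \\ &=\frac{1}{2}\sum_{j=r}^{n}\sum_{i=0}^{j}(-1)^{j-i}\frac{1}{j!}\binom{j}{i}S_{1,\lambda}^{Y}(j,r)\big(q(i+1)+q(i)\big) \\ &=\frac{1}{2}\sum_{j=r}^{n}\sum_{l=j}^{n}S_{1,\lambda}^{Y}(j,r)S_{2}(l,j)\frac{1}{l!}\big(q^{(l)}(1)+q^{(l)}(0) \big). \end{align*}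
   Context: Existence of the moment generating function near the origin means that for some $r_0>0$, $E[e^{Yt}]=\sum_{n\ge 0}E[Y^n]\frac{t^n}{n!}$ exists for $|t|<r_0$. Put $(x)_{0,\lambda}=1$, $(x)_{n,\lambda}=x(x-\lambda)\cdots(x-(n-1)\lambda)$, and $e_\lambda^x(t)=(1+\lambda t)^{x/\lambda}=\sum_{n\ge0}(x)_{n,\lambda}\frac{t^n}{n!}$; $E[e_\lambda^Y(t)]=\sum_{n\ge0}E[(Y)_{n,\lambda}]\frac{t^n}{n!}$ as a power series in $t$. The probabilistic degenerate Euler polynomials $\mathcal{E}_{n,\lambda}^Y(x)$ associated with $Y$ are defined by $$\frac{2}{E[e_\lambda^{Y}(t)]+1}\big(E[e_\lambda^{Y}(t)]\big)^{x}=\sum_{n=0}^{\infty}\mathcal{E}_{n,\lambda}^{Y}(x)\frac{t^{n}}{n!},$$ where $(E[e_\lambda^{Y}(t)])^x=\sum_{k\ge0}(x)_k\frac{1}{k!}(E[e_\lambda^{Y}(t)]-1)^k$ and $(x)_0=1$, $(x)_k=x(x-1)\cdots(x-k+1)$. Put $e_{Y,\lambda}(t)=E[e_\lambda^Y(t)]-1$, a power series with zero constant term and linear coefficient $E[Y]\ne0$, and let $\bar e_{Y,\lambda}(t)$ be its compositional inverse; the probabilistic degenerate Stirling numbers of the first kind associated with $Y$ are defined, for $k\ge0$, by $\frac{1}{k!}(\bar e_{Y,\lambda}(t))^k=\sum_{n\ge k}S_{1,\lambda}^Y(n,k)\frac{t^n}{n!}$. $S_2(n,k)$ are the Stirling numbers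 of the second kind, $\frac{1}{k!}(e^t-1)^k=\sum_{n\ge k}S_2(n,k)\frac{t^n}{n!}$. $\Delta$ is the forward difference operator, $\Delta a(x)=a(x+1)-a(x)$; $\Delta^jq(c)$ denotes $\Delta^j q(x)$ evaluated at $x=c$, and $q^{(l)}$ is the $l$-th derivative. *)

theory Defs
  imports
    "HOL-Probability.Probability"
    "HOL-Computational_Algebra.Computational_Algebra"
    "HOL-Combinatorics.Stirling"
begin

unbundle no vec_syntax

definition mgf_exists_near_0 :: "'w measure \<Rightarrow> ('w \<Rightarrow> real) \<Rightarrow> bool" where
  "mgf_exists_near_0 M Y \<longleftrightarrow>
     (\<exists>r0>0. \<forall>t. \<bar>t\<bar> < r0 \<longrightarrow> integrable M (\<lambda>w. exp (Y w * t)))"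

definition degenerate_ffact :: "'a::comm_ring_1 \<Rightarrow> 'a \<Rightarrow> nat \<Rightarrow> 'a" where
  "degenerate_ffact lam x n = (\<Prod>i<n. x - of_nat i * lam)"

text \<open>
  Sanity check: the exponential generating function of \<open>degenerate_ffact lam x\<close> is the
  degenerate exponential, that is \<open>(1 + lam * t)\<close> raised to \<open>x / lam\<close>.
\<close>

lemma degenerate_exp:
  fixes lam x :: "'a::field_char_0"
  assumes "lam \<noteq> 0"
  shows "Abs_fps (\<lambda>n. degenerate_ffact lam x n / fact n) =
         fps_binomial (x / lam) oo (fps_const lam * fps_X)"
proof (rule fps_ext)
  fix n
  have "degenerate_ffact lam x n = (\<Prod>i<n. lam * (x / lam - of_nat i))"
    unfolding degenerate_ffact_def using assms by (intro prod.cong) (auto simp: field_simps)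
  also have "\<dots> = lam ^ n * (\<Prod>i<n. x / lam - of_nat i)"
    by (simp add: prod.distrib)
  finally show "Abs_fps (\<lambda>n. degenerate_ffact lam x n / fact n) $ n =
      (fps_binomial (x / lam) oo (fps_const lam * fps_X)) $ n"
    by (simp add: gbinomial_prod_rev atLeast0LessThan)
qed

text \<open>
  The power series of \<open>E[e_lam^Y(t)]\<close>. All power series are taken over the complex numbers,
  because the polynomials to be expanded have complex coefficients.
\<close>

definition prob_degenerate_exp ::
    "'w measure \<Rightarrow> ('w \<Rightarrow> real) \<Rightarrow> real \<Rightarrow> complex fps" where
  "prob_degenerate_exp M Y lam =
     Abs_fps (\<lambda>n. complex_of_real (\<integral>w. degenerate_ffact lam (Y w) n \<partial>M) / fact n)"

text \<open>
  \<open>F\<close> to the power \<open>x\<close>, for a power series \<open>F\<close> with constant term 1: the coefficient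
  \<open>x gchoose k\<close> of the series \<open>fps_binomial x\<close> is \<open>x (x - 1) \<dots> (x - k + 1) / k!\<close>, so this is
  the sum of \<open>(x gchoose k) * (F - 1) ^ k\<close> over all \<open>k\<close>.
\<close>

definition fps_cpow :: "complex fps \<Rightarrow> complex \<Rightarrow> complex fps" where
  "fps_cpow F x = fps_binomial x oo (F - 1)"

definition prob_degenerate_Euler ::
    "'w measure \<Rightarrow> ('w \<Rightarrow> real) \<Rightarrow> real \<Rightarrow> nat \<Rightarrow> complex \<Rightarrow> complex" where
  "prob_degenerate_Euler M Y lam n x =
     fact n * (2 / (prob_degenerate_exp M Y lam + 1) *
               fps_cpow (prob_degenerate_exp M Y lam) x) $ n"

text \<open>
  \<open>fps_inv\<close> is the compositional inverse; it is meaningful here when \<open>Y\<close> has nonzero mean, as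
  the argument then has zero constant term and nonzero linear coefficient.
\<close>

definition prob_degenerate_Stirling1 ::
    "'w measure \<Rightarrow> ('w \<Rightarrow> real) \<Rightarrow> real \<Rightarrow> nat \<Rightarrow> nat \<Rightarrow> complex" where
  "prob_degenerate_Stirling1 M Y lam n k =
     fact n * (fps_const (1 / fact k) * fps_inv (prob_degenerate_exp M Y lam - 1) ^ k) $ n"

lemma prob_degenerate_exp_nth_0_1:
  assumes "prob_space M"
  shows "prob_degenerate_exp M Y lam $ 0 = 1"
    and "prob_degenerate_exp M Y lam $ 1 = complex_of_real (\<integral>w. Y w \<partial>M)"
  using assms by (simp_all add: prob_degenerate_exp_def degenerate_ffact_def prob_space.prob_space)

text \<open>
  The library's \<^const>\<open>Stirling\<close> numbers of the second kind, defined there by recursion, have the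
  usual exponential generating function.
\<close>

lemma Stirling_egf:
  "of_nat (Stirling n k) =
     fact n * (fps_const (1 / fact k) * (fps_exp 1 - 1) ^ k :: complex fps) $ n"
proof -
  define F :: "nat \<Rightarrow> complex fps"
    where "F k = fps_const (1 / fact k) * (fps_exp 1 - 1) ^ k" for k
  have D: "fps_deriv (F (Suc k)) = fps_const (of_nat (Suc k)) * F (Suc k) + F k" for k
  proof -
    have "fps_deriv ((fps_exp 1 - 1) ^ Suc k) =
        fps_const (of_nat (Suc k)) * ((fps_exp 1 - 1) ^ k * fps_exp 1 :: complex fps)"
      by (subst fps_deriv_power) (simp add: mult_ac del: of_nat_Suc power_Suc)
    then have "fps_deriv (F (Suc k)) =
        fps_const (1 / fact (Suc k) * of_nat (Suc k)) * ((fps_exp 1 - 1) ^ k * fps_exp 1)"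
      unfolding F_def
      by (simp only: fps_deriv_mult_const_left fps_const_mult [symmetric] mult.assoc)
    also have "1 / fact (Suc k) * of_nat (Suc k) = (1 / fact k :: complex)"
      by (simp add: field_simps del: of_nat_Suc)
    also have "(fps_exp 1 - 1) ^ k * fps_exp 1 =
        (fps_exp 1 - 1) ^ Suc k + (fps_exp 1 - 1 :: complex fps) ^ k"
      by (simp add: algebra_simps)
    also have "fps_const (1 / fact k) * \<dots> =
        fps_const (of_nat (Suc k) * (1 / fact (Suc k))) * (fps_exp 1 - 1) ^ Suc k + F k"
      by (simp add: F_def ring_distribs field_simps del: of_nat_Suc)
    finally show ?thesis
      unfolding F_def by (simp only: fps_const_mult [symmetric] mult.assoc)
  qed
  have S: "fact (Suc n) * F (Suc k) $ Suc n =
      of_nat (Suc k) * (fact n * F (Suc k) $ n) + fact n * F k $ n" for n k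
    using arg_cong[OF D[of k], of "\<lambda>f. fact n * f $ n"]
    by (simp add: algebra_simps)
  have "of_nat (Stirling n k) = fact n * F k $ n"
  proof (induction n k rule: Stirling.induct)
    case (4 n k)
    then show ?case
      by (subst S) (simp add: ring_distribs)
  qed (simp_all add: F_def)
  then show ?thesis
    by (simp add: F_def)
qed

definition forward_difference :: "(complex \<Rightarrow> complex) \<Rightarrow> complex \<Rightarrow> complex" where
  "forward_difference f x = f (x + 1) - f x"

end

theory Submission
  imports Defs
begin

text \<open>
  Write \<open>F\<close> for the power series \<open>E[e_lam^Y(t)]\<close> and \<open>u = F - 1\<close>, so that \<open>u\<close> has zero constant term
  and linear coefficient \<open>E[Y]\<close>, which is nonzero. Let \<open>v\<close> be the compositional inverse of \<open>u\<close>.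

  The variable \<open>x\<close> enters the generating function of the Euler polynomials only through \<open>F\<close> to the
  power \<open>x\<close>. Shifting \<open>x\<close> by one multiplies this by \<open>F\<close>, so \<open>\<Delta>\<close> multiplies it by \<open>u\<close>, and
  \<open>\<Delta>\<^sup>j\<close> multiplies it by \<open>u\<^sup>j\<close>. Adding the values at \<open>1\<close> and \<open>0\<close> gives a further factor \<open>F + 1\<close>,
  which cancels the denominator. Hence \<open>\<Delta>\<^sup>j\<close> of the \<open>m\<close>-th Euler polynomial, summed over the points
  \<open>1\<close> and \<open>0\<close>, is \<open>2 m!\<close> times the coefficient of \<open>t\<^sup>m\<close> in \<open>u\<^sup>j\<close>
  (\<open>forward_difference_iterate_Euler\<close>, where the factor \<open>m!\<close> is left out).

  The Stirling numbers of the first kind are the coefficients of the powers of \<open>v\<close>, up to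
  factorials. Since \<open>v\<^sup>r\<close> composed with \<open>u\<close> is \<open>t\<^sup>r\<close>, they form the matrix inverse to that of the
  coefficients of the powers of \<open>u\<close> (\<open>fps_inv_power_orthogonality\<close>). Thus an expansion of \<open>q\<close> in Euler
  polynomials can be solved for its coefficients, which is the first formula. The other two
  rewrite \<open>\<Delta>\<^sup>j q(c)\<close> by the binomial formula
  (\<open>forward_difference_iterate_explicit\<close>) and by Taylor expansion
  (\<open>forward_difference_iterate_poly\<close>).

  To see that every polynomial has such an expansion, note that composing the generating function
  with \<open>v\<close> expresses \<open>x gchoose k\<close> through the first \<open>k + 1\<close> Euler polynomials
  (\<open>gbinomial_eq_sum_Euler\<close>), and the Stirling numbers of the second kind express the monomials
  through the \<open>x gchoose k\<close> (\<open>power_eq_sum_Stirling_gbinomial\<close>).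
\<close>

section \<open>Iterated forward differences\<close>

lemma forward_difference_iterate_sum:
  "(forward_difference ^^ j) (\<lambda>x. \<Sum>i\<in>A. c i * f i x) =
   (\<lambda>x. \<Sum>i\<in>A. c i * (forward_difference ^^ j) (f i) x)"
  by (induction j)
     (simp_all add: forward_difference_def fun_eq_iff right_diff_distrib sum_subtractf)

lemma forward_difference_iterate_shift:
  "(forward_difference ^^ j) (\<lambda>s. f (x + s)) = (\<lambda>s. (forward_difference ^^ j) f (x + s))"
  by (induction j) (simp_all add: forward_difference_def fun_eq_iff add.assoc)

text \<open>
  A generating function in which a unit shift of \<open>x\<close> acts as multiplication by \<open>P\<close> turns \<open>\<Delta>\<close> into
  multiplication by \<open>P - 1\<close>. This is used with \<open>P = F\<close> for the Euler polynomials and with \<open>P = e\<^sup>t\<close>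
  for the monomials.
\<close>

lemma forward_difference_iterate_fps_nth:
  assumes "\<And>x. G (x + 1) = G x * P"
  shows "(forward_difference ^^ j) (\<lambda>x. (C * G x) $ n) = (\<lambda>x. (C * G x * (P - 1) ^ j) $ n)"
proof (induction j)
  case (Suc j)
  have "C * G (x + 1) * (P - 1) ^ j - C * G x * (P - 1) ^ j = C * G x * (P - 1) ^ Suc j" for x
    unfolding assms by (simp add: algebra_simps)
  then have "forward_difference (\<lambda>x. (C * G x * (P - 1) ^ j) $ n) x =
      (C * G x * (P - 1) ^ Suc j) $ n" for x
    by (simp only: forward_difference_def flip: fps_sub_nth)
  then show ?case
    by (simp only: funpow.simps o_apply Suc)
qed simp

lemma forward_difference_iterate_explicit:
  "(forward_difference ^^ j) f x =
   (\<Sum>i=0..j. (- 1) ^ (j - i) * of_nat (j choose i) * f (x + of_nat i))"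
proof (induction j arbitrary: x)
  case (Suc j)
  let ?h = "\<lambda>i. f (x + of_nat i)"
  have "(forward_difference ^^ Suc j) f x =
      (\<Sum>i\<le>j. (- 1) ^ (j - i) * of_nat (j choose i) * ?h (Suc i)) -
      (\<Sum>i\<le>j. (- 1) ^ (j - i) * of_nat (j choose i) * ?h i)"
    by (simp add: forward_difference_def Suc atLeast0AtMost algebra_simps)
  also have "(\<Sum>i\<le>j. (- 1) ^ (j - i) * of_nat (j choose i) * ?h i) =
      (\<Sum>i\<le>Suc j. (- 1) ^ (j - i) * of_nat (j choose i) * ?h i)"
    by (simp add: binomial_eq_0)
  also have "\<dots> = (- 1) ^ j * ?h 0 +
      (\<Sum>i\<le>j. (- 1) ^ (j - Suc i) * of_nat (j choose Suc i) * ?h (Suc i))"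
    by (subst sum.atMost_Suc_shift) simp
  also have "(\<Sum>i\<le>j. (- 1) ^ (j - Suc i) * of_nat (j choose Suc i) * ?h (Suc i)) =
      - (\<Sum>i\<le>j. (- 1) ^ (j - i) * of_nat (j choose Suc i) * ?h (Suc i))"
    unfolding sum_negf [symmetric]
  proof (intro sum.cong refl)
    fix i assume "i \<in> {..j}"
    show "(- 1) ^ (j - Suc i) * of_nat (j choose Suc i) * ?h (Suc i) =
        - ((- 1) ^ (j - i) * of_nat (j choose Suc i) * ?h (Suc i))"
    proof (cases "i < j")
      case True
      then have "j - i = Suc (j - Suc i)" by simp
      then show ?thesis by simp
    qed (simp add: binomial_eq_0)
  qed
  finally show ?case
    unfolding atLeast0AtMost
    by (subst sum.atMost_Suc_shift) (simp add: sum.distrib algebra_simps)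
qed simp

text \<open>
  The monomials have the generating function \<open>e\<^sup>x\<^sup>t\<close>, on which \<open>\<Delta>\<close> acts as \<open>e\<^sup>t - 1\<close>; the powers of
  the latter generate the Stirling numbers of the second kind.
\<close>

lemma forward_difference_iterate_power_0:
  "(forward_difference ^^ j) (\<lambda>x. x ^ l) 0 = fact j * of_nat (Stirling l j)"
proof -
  let ?G = "\<lambda>x::complex. fps_exp x"
  have "(\<lambda>x::complex. x ^ l) = (\<lambda>x. (fps_const (fact l) * ?G x) $ l)"
    by (simp add: fun_eq_iff)
  then have "(forward_difference ^^ j) (\<lambda>x. x ^ l) 0 =
      (fps_const (fact l) * ?G 0 * (fps_exp 1 - 1) ^ j) $ l"
    using forward_difference_iterate_fps_nth[of ?G "fps_exp 1" j "fps_const (fact l)" l]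
    by (simp add: fps_exp_add_mult)
  then show ?thesis
    by (simp add: Stirling_egf)
qed

text \<open>
  As a polynomial in \<open>s\<close>, the left-hand side has \<open>l!\<close> times its \<open>l\<close>-th coefficient equal to its
  \<open>l\<close>-th derivative at \<open>s = 0\<close>.
\<close>

lemma poly_Taylor:
  fixes q :: "complex poly"
  shows "poly q (x + s) = (\<Sum>l\<le>degree q. poly ((pderiv ^^ l) q) x / fact l * s ^ l)"
proof -
  define p where "p = pcompose q [:x, 1:]"
  have deriv: "(pderiv ^^ l) p = pcompose ((pderiv ^^ l) q) [:x, 1:]" for l
    by (induction l) (simp_all add: p_def pderiv_pcompose pderiv_pCons)
  have coeff: "coeff p l = poly ((pderiv ^^ l) q) x / fact l" for l
  proof -
    have "fact l * coeff p l = coeff ((pderiv ^^ l) p) 0"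
      by (simp add: coeff_higher_pderiv pochhammer_fact)
    also have "\<dots> = poly ((pderiv ^^ l) q) x"
      by (simp add: deriv poly_pcompose flip: poly_0_coeff_0)
    finally show ?thesis by (simp add: field_simps)
  qed
  have "degree p = degree q"
    by (simp add: p_def degree_pcompose)
  have "poly q (x + s) = poly p s"
    by (simp add: p_def poly_pcompose)
  also have "\<dots> = (\<Sum>l\<le>degree q. coeff p l * s ^ l)"
    by (simp add: poly_altdef \<open>degree p = degree q\<close>)
  finally show ?thesis by (simp add: coeff)
qed

text \<open>
  Differences of \<open>q\<close> at \<open>x\<close> are differences of \<open>q(x + s)\<close> in \<open>s\<close> at \<open>s = 0\<close>, where those of the
  powers of \<open>s\<close> in the Taylor expansion are multiples of Stirling numbers.
\<close>

lemma forward_difference_iterate_poly: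
  "(forward_difference ^^ j) (poly q) x =
   fact j * (\<Sum>l=j..degree q. of_nat (Stirling l j) * (1 / fact l) * poly ((pderiv ^^ l) q) x)"
proof -
  have "(forward_difference ^^ j) (poly q) x = (forward_difference ^^ j) (\<lambda>s. poly q (x + s)) 0"
    by (simp add: forward_difference_iterate_shift)
  also have "\<dots> = (\<Sum>l\<le>degree q. poly ((pderiv ^^ l) q) x / fact l *
      (fact j * of_nat (Stirling l j)))"
    by (simp only: poly_Taylor forward_difference_iterate_sum forward_difference_iterate_power_0)
  also have "\<dots> = (\<Sum>l=j..degree q. poly ((pderiv ^^ l) q) x / fact l *
      (fact j * of_nat (Stirling l j)))"
    by (rule sum.mono_neutral_right) auto
  finally show ?thesis
    by (simp add: sum_distrib_left mult_ac)
qed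

text \<open>
  Multiplying the expansion of \<open>x\<^sup>l\<close> by \<open>x\<close> turns \<open>x gchoose k\<close> into
  \<open>k (x gchoose k) + (k + 1) (x gchoose (k + 1))\<close>, which is the recursion of the Stirling numbers.
\<close>

lemma power_eq_sum_Stirling_gbinomial:
  fixes x :: "'a::field_char_0"
  shows "x ^ l = (\<Sum>k\<le>l. of_nat (Stirling l k) * fact k * (x gchoose k))"
proof (induction l)
  case (Suc l)
  let ?S = "\<lambda>k. of_nat (Stirling l k) :: 'a"
  have "x ^ Suc l = (\<Sum>k\<le>l. ?S k * fact k * (x * (x gchoose k)))"
    by (simp add: Suc sum_distrib_left mult_ac)
  also have "\<dots> = (\<Sum>k\<le>l. of_nat k * ?S k * fact k * (x gchoose k)) +
      (\<Sum>k\<le>l. ?S k * fact (Suc k) * (x gchoose Suc k))"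
    by (subst gbinomial_mult_1) (simp add: sum.distrib algebra_simps)
  also have "(\<Sum>k\<le>l. of_nat k * ?S k * fact k * (x gchoose k)) =
      (\<Sum>k\<le>Suc l. of_nat k * ?S k * fact k * (x gchoose k))"
    by simp
  also have "\<dots> = (\<Sum>k\<le>l. of_nat (Suc k) * ?S (Suc k) * fact (Suc k) * (x gchoose Suc k))"
    by (subst sum.atMost_Suc_shift) simp
  also have "\<dots> + (\<Sum>k\<le>l. ?S k * fact (Suc k) * (x gchoose Suc k)) =
      (\<Sum>k\<le>l. of_nat (Stirling (Suc l) (Suc k)) * fact (Suc k) * (x gchoose Suc k))"
    by (simp only: Stirling.simps of_nat_add of_nat_mult distrib_right sum.distrib)
  also have "\<dots> = (\<Sum>k\<le>Suc l. of_nat (Stirling (Suc l) k) * fact k * (x gchoose k))"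
    by (subst sum.atMost_Suc_shift) simp
  finally show ?case .
qed simp

section \<open>Composition with the compositional inverse\<close>

lemma fps_mult_compose_nth:
  fixes H v :: "'a::idom fps"
  assumes "v $ 0 = 0" and "k \<le> n"
  shows "(C * (H oo v)) $ k = (\<Sum>r=0..n. H $ r * (C * v ^ r) $ k)"
proof -
  have "(H oo v) $ m = (\<Sum>r=0..n. H $ r * (v ^ r) $ m)" if "m \<le> n" for m
    unfolding fps_compose_nth
    using that assms(1) by (intro sum.mono_neutral_left) (auto simp: startsby_zero_power_prefix)
  then have "(C * (H oo v)) $ k =
      (\<Sum>i=0..k. C $ i * (\<Sum>r=0..n. H $ r * (v ^ r) $ (k - i)))"
    using assms(2) by (simp add: fps_mult_nth)
  also have "\<dots> = (\<Sum>r=0..n. \<Sum>i=0..k. C $ i * (H $ r * (v ^ r) $ (k - i)))"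
    unfolding sum_distrib_left by (rule sum.swap)
  finally show ?thesis
    by (simp add: fps_mult_nth sum_distrib_left mult_ac)
qed

text \<open>
  The coefficients of the powers of \<open>u\<close> and those of the powers of its compositional inverse form
  mutually inverse triangular matrices, because composing the \<open>r\<close>-th power of the inverse with \<open>u\<close>
  gives the \<open>r\<close>-th power of the variable.
\<close>

lemma fps_inv_power_orthogonality:
  fixes u :: "'a::field fps"
  assumes "u $ 0 = 0" and "u $ 1 \<noteq> 0" and "m \<le> n"
  shows "(\<Sum>j=r..n. (fps_inv u ^ r) $ j * (u ^ j) $ m) = (if m = r then 1 else 0)"
proof -
  have "fps_inv u $ 0 = 0"
    by (simp add: fps_inv_def)
  then have "(\<Sum>j=r..n. (fps_inv u ^ r) $ j * (u ^ j) $ m) =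
      (\<Sum>j=0..n. (fps_inv u ^ r) $ j * (u ^ j) $ m)"
    by (intro sum.mono_neutral_left) (auto simp: startsby_zero_power_prefix)
  also have "\<dots> = (fps_inv u ^ r oo u) $ m"
    using fps_mult_compose_nth[OF assms(1,3), of 1 "fps_inv u ^ r"] by simp
  also have "fps_inv u ^ r oo u = fps_X ^ r"
    using assms by (simp add: fps_inv flip: fps_compose_power)
  finally show ?thesis by simp
qed

section \<open>The generating function of the Euler polynomials\<close>

lemma fps_cpow_0 [simp]: "fps_cpow F 0 = 1"
  by (simp add: fps_cpow_def fps_binomial_0)

lemma fps_cpow_add_1:
  assumes "F $ 0 = 1"
  shows "fps_cpow F (x + 1) = fps_cpow F x * F"
  using assms
  by (simp add: fps_cpow_def fps_binomial_add_mult fps_binomial_1 fps_compose_mult_distrib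
      fps_compose_add_distrib)

text \<open>
  The sum over the points \<open>1\<close> and \<open>0\<close> is what removes the denominator \<open>F + 1\<close>.
\<close>

lemma forward_difference_iterate_Euler:
  assumes "F $ 0 = 1"
  defines "H \<equiv> \<lambda>m x. (2 / (F + 1) * fps_cpow F x) $ m"
  shows "(forward_difference ^^ j) (H m) 1 + (forward_difference ^^ j) (H m) 0 = 2 * ((F - 1) ^ j) $ m"
proof -
  have "(F + 1) $ 0 \<noteq> 0"
    using assms by simp
  then have cancel: "2 / (F + 1) * (F + 1) = 2"
    by (simp add: fps_divide_unit mult.assoc inverse_mult_eq_1)
  have "fps_cpow F 1 = F"
    using fps_cpow_add_1[OF assms(1), of 0] by simp
  then have "(forward_difference ^^ j) (H m) 1 + (forward_difference ^^ j) (H m) 0 =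
      (2 / (F + 1) * (F + 1) * (F - 1) ^ j) $ m"
    unfolding H_def
      forward_difference_iterate_fps_nth[where G = "fps_cpow F", OF fps_cpow_add_1[OF assms(1)]]
    by (simp add: algebra_simps)
  then show ?thesis
    unfolding cancel by (simp add: numeral_fps_const)
qed

text \<open>
  Composing \<open>F\<close> to the power \<open>x\<close> with the compositional inverse of \<open>F - 1\<close> gives the binomial series
  back. Since \<open>F\<close> to the power \<open>x\<close> is \<open>(F + 1) / 2\<close> times the generating function of the Euler
  polynomials, comparing coefficients expresses each \<open>x gchoose k\<close> by Euler polynomials.
\<close>

lemma gbinomial_eq_sum_Euler:
  assumes "F $ 0 = 1" and "F $ 1 \<noteq> 0"
  obtains B where "\<And>k n x. k \<le> n \<Longrightarrow>
    (x gchoose k) = (\<Sum>r=0..n. B k r * (2 / (F + 1) * fps_cpow F x) $ r)"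
proof
  define v where "v = fps_inv (F - 1)"
  define C where "C = (fps_const (1 / 2) * (F + 1)) oo v"
  fix k n :: nat and x :: complex
  assume "k \<le> n"
  define H where "H = 2 / (F + 1) * fps_cpow F x"
  have v0: "v $ 0 = 0"
    by (simp add: v_def fps_inv_def)
  have "(F + 1) $ 0 \<noteq> 0"
    using assms by simp
  then have "inverse (F + 1) * (F + 1) = 1"
    by (rule inverse_mult_eq_1)
  then have "fps_const (1 / 2) * (F + 1) * H = fps_const (1 / 2) * 2 * fps_cpow F x"
    using \<open>(F + 1) $ 0 \<noteq> 0\<close> by (simp add: H_def fps_divide_unit mult_ac)
  also have "fps_const (1 / 2) * 2 = (1 :: complex fps)"
    by (simp add: numeral_fps_const fps_const_mult)
  finally have "fps_cpow F x = fps_const (1 / 2) * (F + 1) * H"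
    by simp
  then have "fps_cpow F x oo v = C * (H oo v)"
    by (simp add: C_def fps_compose_mult_distrib[OF v0])
  moreover have "fps_cpow F x oo v = fps_binomial x"
  proof -
    have "(F - 1) oo v = fps_X"
      unfolding v_def using assms by (intro fps_inv_right) simp_all
    then show ?thesis
      using assms by (simp add: fps_cpow_def v0 flip: fps_compose_assoc)
  qed
  ultimately have "(x gchoose k) = (C * (H oo v)) $ k"
    by (metis fps_binomial_nth)
  then show "(x gchoose k) = (\<Sum>r=0..n. (C * v ^ r) $ k * H $ r)"
    using fps_mult_compose_nth[OF v0 \<open>k \<le> n\<close>, of C H] by (simp add: mult_ac)
qed

text \<open>
  Expanding the monomials in the \<open>x gchoose k\<close> and these in Euler polynomials gives the expansion of
  an arbitrary polynomial.
\<close>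

lemma poly_eq_sum_Euler:
  assumes "F $ 0 = 1" and "F $ 1 \<noteq> 0"
  shows "\<exists>b. \<forall>x. poly q x = (\<Sum>r=0..degree q. b r * (2 / (F + 1) * fps_cpow F x) $ r)"
proof -
  obtain B where B: "\<And>k n x. k \<le> n \<Longrightarrow>
      (x gchoose k) = (\<Sum>r=0..n. B k r * (2 / (F + 1) * fps_cpow F x) $ r)"
    using gbinomial_eq_sum_Euler[OF assms] by blast
  let ?n = "degree q" and ?H = "\<lambda>x. 2 / (F + 1) * fps_cpow F x"
  let ?c = "\<lambda>l k. coeff q l * (of_nat (Stirling l k) * fact k)"
  have "poly q x = (\<Sum>r=0..?n. (\<Sum>l\<le>?n. \<Sum>k\<le>l. ?c l k * B k r) * ?H x $ r)" for x
  proof -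
    have "poly q x = (\<Sum>l\<le>?n. \<Sum>k\<le>l. ?c l k * (x gchoose k))"
      by (simp add: poly_altdef power_eq_sum_Stirling_gbinomial sum_distrib_left mult_ac)
    also have "\<dots> = (\<Sum>l\<le>?n. \<Sum>k\<le>l. \<Sum>r=0..?n. ?c l k * B k r * ?H x $ r)"
      by (intro sum.cong refl, subst B[where n = ?n]) (auto simp: sum_distrib_left mult_ac)
    also have "\<dots> = (\<Sum>l\<le>?n. \<Sum>r=0..?n. \<Sum>k\<le>l. ?c l k * B k r * ?H x $ r)"
      by (intro sum.cong refl sum.swap)
    also have "\<dots> = (\<Sum>r=0..?n. \<Sum>l\<le>?n. \<Sum>k\<le>l. ?c l k * B k r * ?H x $ r)"
      by (rule sum.swap)
    finally show ?thesis
      by (simp add: sum_distrib_right)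
  qed
  then show ?thesis
    by (intro exI[of _ "\<lambda>r. \<Sum>l\<le>?n. \<Sum>k\<le>l. ?c l k * B k r"] allI)
qed

section \<open>Expansion of polynomials in Euler polynomials\<close>

theorem theorem3p4:
  fixes M :: "'w measure" and Y :: "'w \<Rightarrow> real" and lam :: real
    and q :: "complex poly" and n :: nat
  assumes "lam \<noteq> 0"
    and "prob_space M"
    and "Y \<in> borel_measurable M"
    and "mgf_exists_near_0 M Y"
    and "(\<integral>w. Y w \<partial>M) \<noteq> 0"
    and "degree q = n"
  shows "(\<exists>a :: nat \<Rightarrow> complex. \<forall>x.
            poly q x = (\<Sum>r=0..n. a r * prob_degenerate_Euler M Y lam r x)) \<and>
         (\<forall>a :: nat \<Rightarrow> complex.
            (\<forall>x. poly q x = (\<Sum>r=0..n. a r * prob_degenerate_Euler M Y lam r x)) \<longrightarrow>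
            (\<forall>r\<in>{0..n}.
               a r = 1 / 2 * (\<Sum>j=r..n. prob_degenerate_Stirling1 M Y lam j r * (1 / fact j) *
                 ((forward_difference ^^ j) (poly q) 1 + (forward_difference ^^ j) (poly q) 0)) \<and>
               a r = 1 / 2 * (\<Sum>j=r..n. \<Sum>i=0..j. (- 1) ^ (j - i) * (1 / fact j) *
                 of_nat (j choose i) * prob_degenerate_Stirling1 M Y lam j r *
                 (poly q (of_nat i + 1) + poly q (of_nat i))) \<and>
               a r = 1 / 2 * (\<Sum>j=r..n. \<Sum>l=j..n. prob_degenerate_Stirling1 M Y lam j r *
                 of_nat (Stirling l j) * (1 / fact l) *
                 (poly ((pderiv ^^ l) q) 1 + poly ((pderiv ^^ l) q) 0))))"
proof -
  define F where "F = prob_degenerate_exp M Y lam"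
  define H where "H x = 2 / (F + 1) * fps_cpow F x" for x
  let ?S = "prob_degenerate_Stirling1 M Y lam"
  have F0: "F $ 0 = 1" and F1: "F $ 1 \<noteq> 0"
    using prob_degenerate_exp_nth_0_1[OF assms(2)] assms(5) by (simp_all add: F_def)
  have Euler: "prob_degenerate_Euler M Y lam r x = fact r * H x $ r" for r x
    by (simp add: prob_degenerate_Euler_def H_def F_def)
  have "\<exists>a. \<forall>x. poly q x = (\<Sum>r=0..n. a r * prob_degenerate_Euler M Y lam r x)"
  proof -
    obtain b where "\<And>x. poly q x = (\<Sum>r=0..n. b r * H x $ r)"
      using poly_eq_sum_Euler[OF F0 F1] assms(6) unfolding H_def by blast
    then have "\<forall>x. poly q x = (\<Sum>r=0..n. b r / fact r * prob_degenerate_Euler M Y lam r x)"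
      by (simp add: Euler)
    then show ?thesis by (intro exI[of _ "\<lambda>r. b r / fact r"])
  qed
  moreover have
    "a r = 1 / 2 * (\<Sum>j=r..n. ?S j r * (1 / fact j) *
       ((forward_difference ^^ j) (poly q) 1 + (forward_difference ^^ j) (poly q) 0)) \<and>
     a r = 1 / 2 * (\<Sum>j=r..n. \<Sum>i=0..j. (- 1) ^ (j - i) * (1 / fact j) *
       of_nat (j choose i) * ?S j r * (poly q (of_nat i + 1) + poly q (of_nat i))) \<and>
     a r = 1 / 2 * (\<Sum>j=r..n. \<Sum>l=j..n. ?S j r * of_nat (Stirling l j) * (1 / fact l) *
       (poly ((pderiv ^^ l) q) 1 + poly ((pderiv ^^ l) q) 0))"
    if q: "\<forall>x. poly q x = (\<Sum>r=0..n. a r * prob_degenerate_Euler M Y lam r x)" and r: "r \<in> {0..n}"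
    for a r
  proof -
    let ?D = "\<lambda>j. (forward_difference ^^ j) (poly q)"
    have diff: "?D j 1 + ?D j 0 = 2 * (\<Sum>m=0..n. a m * fact m * ((F - 1) ^ j) $ m)" for j
    proof -
      have "poly q = (\<lambda>x. \<Sum>m=0..n. (a m * fact m) * H x $ m)"
        using q by (simp add: fun_eq_iff Euler mult.assoc)
      then have "?D j 1 + ?D j 0 =
          (\<Sum>m=0..n. a m * fact m * ((forward_difference ^^ j) (\<lambda>x. H x $ m) 1 +
             (forward_difference ^^ j) (\<lambda>x. H x $ m) 0))"
        by (simp only: forward_difference_iterate_sum sum.distrib distrib_left)
      then show ?thesis
        unfolding H_def forward_difference_iterate_Euler[OF F0]
        by (simp add: sum_distrib_left mult_ac)
    qed
    have S: "?S j r * (1 / fact j) = (fps_inv (F - 1) ^ r) $ j / fact r" for j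
      by (simp add: prob_degenerate_Stirling1_def F_def)
    have "1 / 2 * (\<Sum>j=r..n. ?S j r * (1 / fact j) * (?D j 1 + ?D j 0)) =
        (\<Sum>j=r..n. \<Sum>m=0..n. a m * fact m / fact r *
           ((fps_inv (F - 1) ^ r) $ j * ((F - 1) ^ j) $ m))"
      unfolding S diff by (simp add: sum_distrib_left mult_ac)
    also have "\<dots> = (\<Sum>m=0..n. a m * fact m / fact r *
        (\<Sum>j=r..n. (fps_inv (F - 1) ^ r) $ j * ((F - 1) ^ j) $ m))"
      unfolding sum_distrib_left by (rule sum.swap)
    also have "\<dots> = (\<Sum>m=0..n. a m * fact m / fact r * (if m = r then 1 else 0))"
      using F0 F1 by (intro sum.cong refl, subst fps_inv_power_orthogonality) auto
    also have "\<dots> = a r"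
      using r by (simp add: if_distrib[of "\<lambda>y. _ * y"] sum.delta' cong: if_cong)
    finally have first: "a r = 1 / 2 * (\<Sum>j=r..n. ?S j r * (1 / fact j) * (?D j 1 + ?D j 0))" ..
    have "?S j r * (1 / fact j) * (?D j 1 + ?D j 0) =
        (\<Sum>i=0..j. (- 1) ^ (j - i) * (1 / fact j) *
           of_nat (j choose i) * ?S j r * (poly q (of_nat i + 1) + poly q (of_nat i)))" for j
      unfolding forward_difference_iterate_explicit
      by (simp add: sum_distrib_left algebra_simps add_divide_distrib flip: sum.distrib)
    moreover have "?S j r * (1 / fact j) * (?D j 1 + ?D j 0) =
        (\<Sum>l=j..n. ?S j r * of_nat (Stirling l j) * (1 / fact l) *
           (poly ((pderiv ^^ l) q) 1 + poly ((pderiv ^^ l) q) 0))" for j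
      unfolding forward_difference_iterate_poly assms(6)
      by (simp add: sum_distrib_left distrib_left add_divide_distrib sum.distrib mult_ac)
    ultimately show ?thesis
      using first by simp
  qed
  ultimately show ?thesis by blast
qed

end
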